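(* The category $\mathbf{Pol}$ of polarities and compatible relations is complete and cocomplete.
   Context: For a binary relation $R\subseteq A\times B$ between sets, define antitone maps $R^{\downarrow}:\mathcal{P}(B)\to\mathcal{P}(A)$ and $R^{\uparrow}:\mathcal{P}(A)\to\mathcal{P}(B)$ by $R^{\downarrow}(Y)=\{a\in A\mid a\mathrel{R}\beta\text{ for all }\beta\in Y\}$ and $R^{\uparrow}(X)=\{\beta\in B\mid a\mathrel{R}\beta\text{ for all }a\in X\}$. Juxtaposition of such maps denotes composition, the rightmost map being applied first. A polarity $\mathcal{A}=(A^-,A^+;\mathcal{A})$ consists of two sets $A^-,A^+$ and a binary relation $\mathcal{A}\subseteq A^-\times A^+$ (its incidence relation, denoted by the same letter). Put $\mathrm{cl}_{\mathcal{A}}=\mathcal{A}^{\downarrow}\mathcal{A}^{\uparrow}$ on $\mathcal{P}(A^-)$ and $\mathrm{cl}^{\mathcal{A}}=\mathcal{A}^{\uparrow}\mathcal{A}^{\downarrow}$ on $\mathcal{P}(A^+)$. For polarities $\mathcal{A},\mathcal{B}$, a relation $R\subseteq A^-\times B^+$ is a compatible relation from $\mathcal{A}$ to $\mathcal{B}$ if $\mathrm{cl}_{\mathcal{A}}R^{\downarrow}=R^{\downarrow}$ and $R^{\downarrow}\mathrm{cl}^{\mathcal{B}}=R^{\downarrow}$. $\mathbf{Pol}$ is the category whose objects are polarities and whose morphisms $\mathcal{A}\to\mathcal{B}$ are the compatible relations from $\mathcal{A}$ to $\mathcal{B}$. The composite of $R:\mathcal{A}\to\mathcal{B}$ and $S:\mathcal{B}\to\mathcal{C}$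 (written in diagrammatic order) is the relation $R\mathbin{;}S\subseteq A^-\times C^+$ with $a\mathrel{(R\mathbin{;}S)}\gamma$ if and only if $a\in R^{\downarrow}\mathcal{B}^{\uparrow}S^{\downarrow}(\{\gamma\})$. The identity on $\mathcal{A}$ is its incidence relation. *)

theory Defs
  imports Main
begin

section \<open>Small categories\<close>

record ('o, 'm) cat =
  Obj :: "'o set"
  Arr :: "'m set"
  Dom :: "'m \<Rightarrow> 'o"
  Cod :: "'m \<Rightarrow> 'o"
  Id :: "'o \<Rightarrow> 'm"
  Comp :: "'m \<Rightarrow> 'm \<Rightarrow> 'm"

text \<open>Composition is written in diagrammatic order: \<open>Comp C f g\<close> is \<open>f\<close> followed by \<open>g\<close>.\<close>

locale category =
  fixes C :: "('o, 'm) cat"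
  assumes Dom_in: "f \<in> Arr C \<Longrightarrow> Dom C f \<in> Obj C"
    and Cod_in: "f \<in> Arr C \<Longrightarrow> Cod C f \<in> Obj C"
    and Id_in: "x \<in> Obj C \<Longrightarrow> Id C x \<in> Arr C"
    and Dom_Id: "x \<in> Obj C \<Longrightarrow> Dom C (Id C x) = x"
    and Cod_Id: "x \<in> Obj C \<Longrightarrow> Cod C (Id C x) = x"
    and Comp_in: "\<lbrakk>f \<in> Arr C; g \<in> Arr C; Cod C f = Dom C g\<rbrakk> \<Longrightarrow> Comp C f g \<in> Arr C"
    and Dom_Comp: "\<lbrakk>f \<in> Arr C; g \<in> Arr C; Cod C f = Dom C g\<rbrakk> \<Longrightarrow> Dom C (Comp C f g) = Dom C f"
    and Cod_Comp: "\<lbrakk>f \<in> Arr C; g \<in> Arr C; Cod C f = Dom C g\<rbrakk> \<Longrightarrow> Cod C (Comp C f g) = Cod C g"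
    and Id_left: "f \<in> Arr C \<Longrightarrow> Comp C (Id C (Dom C f)) f = f"
    and Id_right: "f \<in> Arr C \<Longrightarrow> Comp C f (Id C (Cod C f)) = f"
    and Comp_assoc: "\<lbrakk>f \<in> Arr C; g \<in> Arr C; h \<in> Arr C; Cod C f = Dom C g; Cod C g = Dom C h\<rbrakk>
      \<Longrightarrow> Comp C (Comp C f g) h = Comp C f (Comp C g h)"

section \<open>Polarities and compatible relations\<close>

definition down :: "'a set \<Rightarrow> ('a \<times> 'b) set \<Rightarrow> 'b set \<Rightarrow> 'a set" where
  "down A R Y = {a \<in> A. \<forall>\<beta>\<in>Y. (a, \<beta>) \<in> R}"

definition up :: "'b set \<Rightarrow> ('a \<times> 'b) set \<Rightarrow> 'a set \<Rightarrow> 'b set" where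
  "up B R X = {\<beta> \<in> B. \<forall>a\<in>X. (a, \<beta>) \<in> R}"

record ('a, 'b) polarity =
  Neg :: "'a set"
  Pos :: "'b set"
  Inc :: "('a \<times> 'b) set"

definition polarity :: "('a, 'b) polarity \<Rightarrow> bool" where
  "polarity A \<longleftrightarrow> Inc A \<subseteq> Neg A \<times> Pos A"

definition cl_neg :: "('a, 'b) polarity \<Rightarrow> 'a set \<Rightarrow> 'a set" where
  "cl_neg A X = down (Neg A) (Inc A) (up (Pos A) (Inc A) X)"

definition cl_pos :: "('a, 'b) polarity \<Rightarrow> 'b set \<Rightarrow> 'b set" where
  "cl_pos A Y = up (Pos A) (Inc A) (down (Neg A) (Inc A) Y)"

definition compatible :: "('a, 'b) polarity \<Rightarrow> ('c, 'd) polarity \<Rightarrow> ('a \<times> 'd) set \<Rightarrow> bool" where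
  "compatible A B R \<longleftrightarrow> R \<subseteq> Neg A \<times> Pos B \<and>
     (\<forall>Y. Y \<subseteq> Pos B \<longrightarrow> cl_neg A (down (Neg A) R Y) = down (Neg A) R Y) \<and>
     (\<forall>Y. Y \<subseteq> Pos B \<longrightarrow> down (Neg A) R (cl_pos B Y) = down (Neg A) R Y)"

text \<open>The composite of \<open>R : A \<rightarrow> B\<close> and \<open>S : B \<rightarrow> C\<close>, in diagrammatic order.\<close>

definition pol_comp :: "('a, 'b) polarity \<Rightarrow> ('c, 'd) polarity \<Rightarrow> ('e, 'f) polarity
    \<Rightarrow> ('a \<times> 'd) set \<Rightarrow> ('c \<times> 'f) set \<Rightarrow> ('a \<times> 'f) set" where
  "pol_comp A B C R S = {(a, \<gamma>). \<gamma> \<in> Pos C \<and>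
     a \<in> down (Neg A) R (up (Pos B) (Inc B) (down (Neg B) S {\<gamma>}))}"

subsection \<open>The category laws\<close>

text \<open>The category of polarities is large. It is rendered type-polymorphically: its objects are the
  polarities whose carriers are sets over arbitrary types, and morphisms may connect polarities over
  different types. The category laws hold in this generality.\<close>

lemma compatible_Inc: "polarity A \<Longrightarrow> compatible A A (Inc A)"
  unfolding polarity_def compatible_def cl_neg_def cl_pos_def down_def up_def by auto

lemma down_comp:
  assumes R: "compatible A B R" and S: "compatible B C S" and Y: "Y \<subseteq> Pos C"
  shows "down (Neg A) (pol_comp A B C R S) Y
       = down (Neg A) R (up (Pos B) (Inc B) (down (Neg B) S Y))"
proof -
  define W where "W = (\<Union>\<gamma>\<in>Y. up (Pos B) (Inc B) (down (Neg B) S {\<gamma>}))"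
  have W: "W \<subseteq> Pos B" by (auto simp: W_def up_def)
  have cl: "down (Neg B) (Inc B) (up (Pos B) (Inc B) (down (Neg B) S {\<gamma>})) = down (Neg B) S {\<gamma>}"
    if "\<gamma> \<in> Y" for \<gamma>
    using S Y that by (auto simp: compatible_def cl_neg_def)
  have "down (Neg B) S Y = {b \<in> Neg B. \<forall>\<gamma>\<in>Y. b \<in> down (Neg B) S {\<gamma>}}"
    by (auto simp: down_def)
  also have "\<dots> = {b \<in> Neg B. \<forall>\<gamma>\<in>Y. b \<in> down (Neg B) (Inc B) (up (Pos B) (Inc B) (down (Neg B) S {\<gamma>}))}"
    using cl by auto
  also have "\<dots> = down (Neg B) (Inc B) W"
    by (auto simp: down_def W_def)
  finally have "down (Neg A) R (up (Pos B) (Inc B) (down (Neg B) S Y)) = down (Neg A) R (cl_pos B W)"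
    by (simp add: cl_pos_def)
  also have "\<dots> = down (Neg A) R W" using R W by (auto simp: compatible_def)
  also have "\<dots> = down (Neg A) (pol_comp A B C R S) Y"
    using Y by (auto simp: down_def W_def pol_comp_def)
  finally show ?thesis by simp
qed

lemma rel_eqI:
  assumes "R \<subseteq> N \<times> P" "S \<subseteq> N \<times> P" "\<And>\<gamma>. \<gamma> \<in> P \<Longrightarrow> down N R {\<gamma>} = down N S {\<gamma>}"
  shows "R = S"
  using assms unfolding down_def set_eq_iff by blast

lemma compatible_comp:
  assumes R: "compatible A B R" and S: "compatible B C S"
  shows "compatible A C (pol_comp A B C R S)"
proof -
  have up: "up (Pos B) (Inc B) X \<subseteq> Pos B" for X by (auto simp: up_def)
  have Pos: "cl_pos C Y \<subseteq> Pos C" for Y by (auto simp: cl_pos_def up_def)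
  show ?thesis
    unfolding compatible_def
  proof (intro conjI allI impI)
    show "pol_comp A B C R S \<subseteq> Neg A \<times> Pos C" by (auto simp: pol_comp_def down_def)
  next
    fix Y assume Y: "Y \<subseteq> Pos C"
    show "cl_neg A (down (Neg A) (pol_comp A B C R S) Y) = down (Neg A) (pol_comp A B C R S) Y"
      using R up by (auto simp: down_comp[OF R S Y] compatible_def)
    have "down (Neg B) S (cl_pos C Y) = down (Neg B) S Y" using S Y by (auto simp: compatible_def)
    then show "down (Neg A) (pol_comp A B C R S) (cl_pos C Y) = down (Neg A) (pol_comp A B C R S) Y"
      by (simp add: down_comp[OF R S Y] down_comp[OF R S Pos])
  qed
qed

lemma pol_comp_subset: "pol_comp A B C R S \<subseteq> Neg A \<times> Pos C"
  by (auto simp: pol_comp_def down_def)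

lemma pol_comp_assoc:
  assumes R: "compatible A B R" and S: "compatible B C S" and T: "compatible C D T"
  shows "pol_comp A C D (pol_comp A B C R S) T = pol_comp A B D R (pol_comp B C D S T)"
proof (rule rel_eqI[OF pol_comp_subset pol_comp_subset])
  fix \<gamma> assume "\<gamma> \<in> Pos D"
  then have Y: "{\<gamma>} \<subseteq> Pos D" by simp
  have up: "up (Pos C) (Inc C) X \<subseteq> Pos C" for X by (auto simp: up_def)
  show "down (Neg A) (pol_comp A C D (pol_comp A B C R S) T) {\<gamma>}
      = down (Neg A) (pol_comp A B D R (pol_comp B C D S T)) {\<gamma>}"
    by (simp add: down_comp[OF compatible_comp[OF R S] T Y] down_comp[OF R compatible_comp[OF S T] Y]
        down_comp[OF R S up] down_comp[OF S T Y])
qed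

lemma pol_comp_Inc_left:
  assumes A: "polarity A" and R: "compatible A B R"
  shows "pol_comp A A B (Inc A) R = R"
proof (rule rel_eqI[OF pol_comp_subset])
  show "R \<subseteq> Neg A \<times> Pos B" using R by (simp add: compatible_def)
  fix \<gamma> assume "\<gamma> \<in> Pos B"
  then have Y: "{\<gamma>} \<subseteq> Pos B" by simp
  show "down (Neg A) (pol_comp A A B (Inc A) R) {\<gamma>} = down (Neg A) R {\<gamma>}"
    using R Y by (simp add: down_comp[OF compatible_Inc[OF A] R Y] compatible_def cl_neg_def)
qed

lemma pol_comp_Inc_right:
  assumes B: "polarity B" and R: "compatible A B R"
  shows "pol_comp A B B R (Inc B) = R"
proof (rule rel_eqI[OF pol_comp_subset])
  show "R \<subseteq> Neg A \<times> Pos B" using R by (simp add: compatible_def)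
  fix \<gamma> assume "\<gamma> \<in> Pos B"
  then have Y: "{\<gamma>} \<subseteq> Pos B" by simp
  show "down (Neg A) (pol_comp A B B R (Inc B)) {\<gamma>} = down (Neg A) R {\<gamma>}"
    using R Y by (simp add: down_comp[OF R compatible_Inc[OF B] Y] compatible_def cl_pos_def)
qed

section \<open>Limits and colimits of small diagrams of polarities\<close>

text \<open>A functor from \<open>J\<close> to the category of polarities, with object part \<open>D\<close> and arrow part \<open>F\<close>.
  The polarities \<open>D j\<close> form a small family, so that their carriers can be taken in common types.\<close>

definition pol_diagram :: "('i, 'm) cat \<Rightarrow> ('i \<Rightarrow> ('a, 'b) polarity) \<Rightarrow> ('m \<Rightarrow> ('a \<times> 'b) set) \<Rightarrow> bool" where
  "pol_diagram J D F \<longleftrightarrow>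
     (\<forall>j\<in>Obj J. polarity (D j)) \<and>
     (\<forall>f\<in>Arr J. compatible (D (Dom J f)) (D (Cod J f)) (F f)) \<and>
     (\<forall>j\<in>Obj J. F (Id J j) = Inc (D j)) \<and>
     (\<forall>f\<in>Arr J. \<forall>g\<in>Arr J. Cod J f = Dom J g \<longrightarrow>
        F (Comp J f g) = pol_comp (D (Dom J f)) (D (Cod J f)) (D (Cod J g)) (F f) (F g))"

definition pol_cone :: "('i, 'm) cat \<Rightarrow> ('i \<Rightarrow> ('a, 'b) polarity) \<Rightarrow> ('m \<Rightarrow> ('a \<times> 'b) set)
    \<Rightarrow> ('x, 'y) polarity \<Rightarrow> ('i \<Rightarrow> ('x \<times> 'b) set) \<Rightarrow> bool" where
  "pol_cone J D F X \<sigma> \<longleftrightarrow> polarity X \<and>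
     (\<forall>j\<in>Obj J. compatible X (D j) (\<sigma> j)) \<and>
     (\<forall>f\<in>Arr J. pol_comp X (D (Dom J f)) (D (Cod J f)) (\<sigma> (Dom J f)) (F f) = \<sigma> (Cod J f))"

definition pol_cocone :: "('i, 'm) cat \<Rightarrow> ('i \<Rightarrow> ('a, 'b) polarity) \<Rightarrow> ('m \<Rightarrow> ('a \<times> 'b) set)
    \<Rightarrow> ('x, 'y) polarity \<Rightarrow> ('i \<Rightarrow> ('a \<times> 'y) set) \<Rightarrow> bool" where
  "pol_cocone J D F X \<sigma> \<longleftrightarrow> polarity X \<and>
     (\<forall>j\<in>Obj J. compatible (D j) X (\<sigma> j)) \<and>
     (\<forall>f\<in>Arr J. pol_comp (D (Dom J f)) (D (Cod J f)) X (F f) (\<sigma> (Cod J f)) = \<sigma> (Dom J f))"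

text \<open>The universal property is tested against all (co)cones whose apex has carriers over the types
  \<open>'x\<close> and \<open>'y\<close>, which are passed as arguments.\<close>

definition pol_limit :: "'x itself \<Rightarrow> 'y itself
    \<Rightarrow> ('i, 'm) cat \<Rightarrow> ('i \<Rightarrow> ('a, 'b) polarity) \<Rightarrow> ('m \<Rightarrow> ('a \<times> 'b) set)
    \<Rightarrow> ('c, 'd) polarity \<Rightarrow> ('i \<Rightarrow> ('c \<times> 'b) set) \<Rightarrow> bool" where
  "pol_limit _ _ J D F L \<pi> \<longleftrightarrow> pol_cone J D F L \<pi> \<and>
     (\<forall>(X :: ('x, 'y) polarity) \<sigma>. pol_cone J D F X \<sigma> \<longrightarrow>
        (\<exists>!R. compatible X L R \<and> (\<forall>j\<in>Obj J. pol_comp X L (D j) R (\<pi> j) = \<sigma> j)))"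

definition pol_colimit :: "'x itself \<Rightarrow> 'y itself
    \<Rightarrow> ('i, 'm) cat \<Rightarrow> ('i \<Rightarrow> ('a, 'b) polarity) \<Rightarrow> ('m \<Rightarrow> ('a \<times> 'b) set)
    \<Rightarrow> ('c, 'd) polarity \<Rightarrow> ('i \<Rightarrow> ('a \<times> 'd) set) \<Rightarrow> bool" where
  "pol_colimit _ _ J D F L \<iota> \<longleftrightarrow> pol_cocone J D F L \<iota> \<and>
     (\<forall>(X :: ('x, 'y) polarity) \<sigma>. pol_cocone J D F X \<sigma> \<longrightarrow>
        (\<exists>!R. compatible L X R \<and> (\<forall>j\<in>Obj J. pol_comp (D j) L X (\<iota> j) R = \<sigma> j)))"

text \<open>A (co)limit that is universal among polarities over its own types is determined there up to
  isomorphism. Hence, if some such (co)limit is also universal for apexes over further types, then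
  every such (co)limit is: which (co)limit is chosen does not depend on the types of the test
  polarities. So universality for arbitrary type variables \<open>'x\<close> and \<open>'y\<close>, together with universality over
  the types of the apex itself, says that one and the same apex is universal in the whole category.\<close>

lemma pol_limit_transfer:
  fixes L L' :: "('c, 'd) polarity"
  assumes L: "pol_limit TYPE('c) TYPE('d) J D F L \<pi>"
    and L': "pol_limit TYPE('c) TYPE('d) J D F L' \<pi>'"
    and X': "pol_limit TYPE('x) TYPE('y) J D F L' \<pi>'"
  shows "pol_limit TYPE('x) TYPE('y) J D F L \<pi>"
proof -
  have c: "pol_cone J D F L \<pi>" "pol_cone J D F L' \<pi>'" using L L' by (auto simp: pol_limit_def)
  then have pol: "polarity L" "polarity L'"
    and cmp: "j \<in> Obj J \<Longrightarrow> compatible L (D j) (\<pi> j)" "j \<in> Obj J \<Longrightarrow> compatible L' (D j) (\<pi>' j)" for j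
    by (auto simp: pol_cone_def)
  obtain u where u: "compatible L L' u" "\<forall>j\<in>Obj J. pol_comp L L' (D j) u (\<pi>' j) = \<pi> j"
    using L' c(1) unfolding pol_limit_def by blast
  obtain v where v: "compatible L' L v" "\<forall>j\<in>Obj J. pol_comp L' L (D j) v (\<pi> j) = \<pi>' j"
    using L c(2) unfolding pol_limit_def by blast
  have "\<forall>j\<in>Obj J. pol_comp L L (D j) (pol_comp L L' L u v) (\<pi> j) = \<pi> j"
    using u v cmp by (simp add: pol_comp_assoc[OF u(1) v(1) cmp(1)])
  moreover have "\<forall>j\<in>Obj J. pol_comp L L (D j) (Inc L) (\<pi> j) = \<pi> j"
    using pol_comp_Inc_left[OF pol(1) cmp(1)] by blast
  ultimately have uv: "pol_comp L L' L u v = Inc L"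
    using L c(1) compatible_comp[OF u(1) v(1)] compatible_Inc[OF pol(1)]
    unfolding pol_limit_def by blast
  have "\<exists>!R. compatible X L R \<and> (\<forall>j\<in>Obj J. pol_comp X L (D j) R (\<pi> j) = \<sigma> j)"
    if "pol_cone J D F X \<sigma>" for X :: "('x, 'y) polarity" and \<sigma>
  proof -
    from X' that have ex: "\<exists>!R. compatible X L' R \<and> (\<forall>j\<in>Obj J. pol_comp X L' (D j) R (\<pi>' j) = \<sigma> j)"
      unfolding pol_limit_def by blast
    then obtain S where S: "compatible X L' S" "\<forall>j\<in>Obj J. pol_comp X L' (D j) S (\<pi>' j) = \<sigma> j"
      by blast
    show ?thesis
    proof (rule ex1I[of _ "pol_comp X L' L S v"], intro conjI ballI)
      show "compatible X L (pol_comp X L' L S v)" by (rule compatible_comp[OF S(1) v(1)])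
      show "pol_comp X L (D j) (pol_comp X L' L S v) (\<pi> j) = \<sigma> j" if "j \<in> Obj J" for j
        using S(2) v(2) that by (simp add: pol_comp_assoc[OF S(1) v(1) cmp(1)])
    next
      fix R assume R: "compatible X L R \<and> (\<forall>j\<in>Obj J. pol_comp X L (D j) R (\<pi> j) = \<sigma> j)"
      then have R1: "compatible X L R" by simp
      have "\<forall>j\<in>Obj J. pol_comp X L' (D j) (pol_comp X L L' R u) (\<pi>' j) = \<sigma> j"
        using R u(2) by (simp add: pol_comp_assoc[OF R1 u(1) cmp(2)])
      then have "pol_comp X L L' R u = S" using ex S compatible_comp[OF R1 u(1)] by blast
      then have "pol_comp X L' L S v = pol_comp X L L R (pol_comp L L' L u v)"
        using pol_comp_assoc[OF R1 u(1) v(1)] by simp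
      also have "\<dots> = R" using uv pol_comp_Inc_right[OF pol(1) R1] by simp
      finally show "R = pol_comp X L' L S v" by simp
    qed
  qed
  then show ?thesis using c(1) by (auto simp: pol_limit_def)
qed

lemma pol_colimit_transfer:
  fixes L L' :: "('c, 'd) polarity"
  assumes L: "pol_colimit TYPE('c) TYPE('d) J D F L \<iota>"
    and L': "pol_colimit TYPE('c) TYPE('d) J D F L' \<iota>'"
    and X': "pol_colimit TYPE('x) TYPE('y) J D F L' \<iota>'"
  shows "pol_colimit TYPE('x) TYPE('y) J D F L \<iota>"
proof -
  have c: "pol_cocone J D F L \<iota>" "pol_cocone J D F L' \<iota>'" using L L' by (auto simp: pol_colimit_def)
  then have pol: "polarity L" "polarity L'"
    and cmp: "j \<in> Obj J \<Longrightarrow> compatible (D j) L (\<iota> j)" "j \<in> Obj J \<Longrightarrow> compatible (D j) L' (\<iota>' j)" for j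
    by (auto simp: pol_cocone_def)
  obtain u where u: "compatible L L' u" "\<forall>j\<in>Obj J. pol_comp (D j) L L' (\<iota> j) u = \<iota>' j"
    using L c(2) unfolding pol_colimit_def by blast
  obtain v where v: "compatible L' L v" "\<forall>j\<in>Obj J. pol_comp (D j) L' L (\<iota>' j) v = \<iota> j"
    using L' c(1) unfolding pol_colimit_def by blast
  have "\<forall>j\<in>Obj J. pol_comp (D j) L L (\<iota> j) (pol_comp L L' L u v) = \<iota> j"
    using u v by (simp add: pol_comp_assoc[OF cmp(1) u(1) v(1), symmetric])
  moreover have "\<forall>j\<in>Obj J. pol_comp (D j) L L (\<iota> j) (Inc L) = \<iota> j"
    using pol_comp_Inc_right[OF pol(1) cmp(1)] by blast
  ultimately have uv: "pol_comp L L' L u v = Inc L"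
    using L c(1) compatible_comp[OF u(1) v(1)] compatible_Inc[OF pol(1)]
    unfolding pol_colimit_def by blast
  have "\<exists>!R. compatible L X R \<and> (\<forall>j\<in>Obj J. pol_comp (D j) L X (\<iota> j) R = \<sigma> j)"
    if "pol_cocone J D F X \<sigma>" for X :: "('x, 'y) polarity" and \<sigma>
  proof -
    from X' that have ex: "\<exists>!R. compatible L' X R \<and> (\<forall>j\<in>Obj J. pol_comp (D j) L' X (\<iota>' j) R = \<sigma> j)"
      unfolding pol_colimit_def by blast
    then obtain S where S: "compatible L' X S" "\<forall>j\<in>Obj J. pol_comp (D j) L' X (\<iota>' j) S = \<sigma> j"
      by blast
    show ?thesis
    proof (rule ex1I[of _ "pol_comp L L' X u S"], intro conjI ballI)
      show "compatible L X (pol_comp L L' X u S)" by (rule compatible_comp[OF u(1) S(1)])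
      show "pol_comp (D j) L X (\<iota> j) (pol_comp L L' X u S) = \<sigma> j" if "j \<in> Obj J" for j
        using S(2) u(2) that by (simp add: pol_comp_assoc[OF cmp(1) u(1) S(1), symmetric])
    next
      fix R assume R: "compatible L X R \<and> (\<forall>j\<in>Obj J. pol_comp (D j) L X (\<iota> j) R = \<sigma> j)"
      then have R1: "compatible L X R" by simp
      have "\<forall>j\<in>Obj J. pol_comp (D j) L' X (\<iota>' j) (pol_comp L' L X v R) = \<sigma> j"
        using R v(2) by (simp add: pol_comp_assoc[OF cmp(2) v(1) R1, symmetric])
      then have "pol_comp L' L X v R = S" using ex S compatible_comp[OF v(1) R1] by blast
      then have "pol_comp L L' X u S = pol_comp L L X (pol_comp L L' L u v) R"
        using pol_comp_assoc[OF u(1) v(1) R1] by simp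
      also have "\<dots> = R" using uv pol_comp_Inc_left[OF pol(1) R1] by simp
      finally show "R = pol_comp L L' X u S" by simp
    qed
  qed
  then show ?thesis using c(1) by (auto simp: pol_colimit_def)
qed

end

theory Submission
  imports Defs
begin

text \<open>Sending a polarity to the complete lattice of its stable sets \<open>X = cl_neg A X\<close>, and a compatible
  relation \<open>R\<close> from \<open>A\<close> to \<open>B\<close> to the map taking \<open>X\<close> to the common lower bounds of
  \<open>up (Pos B) R X\<close>, is an equivalence with the category of complete lattices and sup-preserving
  maps. There, limits are computed as for sets: the limit of a diagram is the lattice of coherent
  families \<open>(X\<^sub>j)\<close> of stable sets, where each transition map takes the member at its source to the
  member at its target. This lattice is presented by a polarity whose negative elements are the
  coherent families and whose positive elements form the disjoint union of the sets \<open>Pos (D j)\<close>, a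
  family being incident with \<open>(j, \<beta>)\<close> iff \<open>\<beta>\<close> is an upper bound of \<open>X\<^sub>j\<close>.

  What makes the universal property short is that the columns of the \<open>j\<close>-th projection are the
  columns over \<open>j\<close> of the incidence relation. Composing with the projection therefore just reads off
  the columns over \<open>j\<close> (\<open>pol_comp_shared_column\<close>), so a mediating relation can only be the disjoint
  union of the legs of the cone. That this union is compatible is where coherence enters: each of its rows is the row of
  a coherent family in the limit polarity (\<open>coherent_of_cone\<close>).

  For colimits, exchanging the two sides of every polarity and reversing every relation is a duality
  of the category of polarities with itself, because compatibility is a closure condition on the
  rows and on the columns (\<open>compatible_iff\<close>), and the formula for composition can be read from either
  side (\<open>mem_pol_comp_iff\<close>). So the colimit of a diagram is the dual of the limit of the dual
  diagram.\<close>

section \<open>Compatible relations in terms of rows and columns\<close>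

lemma cl_neg_down: "Y \<subseteq> Pos A \<Longrightarrow>
    cl_neg A (down (Neg A) (Inc A) Y) = down (Neg A) (Inc A) Y"
  unfolding cl_neg_def up_def down_def by auto

lemma cl_pos_up: "X \<subseteq> Neg A \<Longrightarrow>
    cl_pos A (up (Pos A) (Inc A) X) = up (Pos A) (Inc A) X"
  unfolding cl_pos_def up_def down_def by auto

text \<open>The two conditions on \<open>down\<close> amount to closedness of all columns and of all rows of \<open>R\<close>, since
  closed sets are stable under intersection. In this form the notion is visibly self-dual.\<close>

lemma compatible_iff:
  "compatible A B R \<longleftrightarrow> R \<subseteq> Neg A \<times> Pos B \<and>
     (\<forall>\<beta>\<in>Pos B. cl_neg A (down (Neg A) R {\<beta>}) = down (Neg A) R {\<beta>}) \<and>
     (\<forall>a\<in>Neg A. cl_pos B (up (Pos B) R {a}) = up (Pos B) R {a})"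
  (is "_ \<longleftrightarrow> ?R \<and> ?cols \<and> ?rows")
proof
  assume cmp: "compatible A B R"
  have "cl_pos B (up (Pos B) R {a}) = up (Pos B) R {a}" if a: "a \<in> Neg A" for a
  proof
    have "up (Pos B) R {a} \<subseteq> Pos B" by (auto simp: up_def)
    then have "down (Neg A) R (cl_pos B (up (Pos B) R {a})) = down (Neg A) R (up (Pos B) R {a})"
      using cmp by (auto simp: compatible_def)
    moreover have "a \<in> down (Neg A) R (up (Pos B) R {a})"
      using a by (auto simp: down_def up_def)
    ultimately show "cl_pos B (up (Pos B) R {a}) \<subseteq> up (Pos B) R {a}"
      by (auto simp: down_def up_def cl_pos_def)
  qed (auto simp: cl_pos_def up_def down_def)
  then show "?R \<and> ?cols \<and> ?rows"
    using cmp by (auto simp: compatible_def)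
next
  assume *: "?R \<and> ?cols \<and> ?rows"
  have cols: "cl_neg A (down (Neg A) R Y) \<subseteq> down (Neg A) R Y" if Y: "Y \<subseteq> Pos B" for Y
  proof
    fix a assume a: "a \<in> cl_neg A (down (Neg A) R Y)"
    have "a \<in> down (Neg A) R {\<beta>}" if "\<beta> \<in> Y" for \<beta>
    proof -
      have "down (Neg A) R Y \<subseteq> down (Neg A) R {\<beta>}"
        using that by (auto simp: down_def)
      then have "cl_neg A (down (Neg A) R Y) \<subseteq> cl_neg A (down (Neg A) R {\<beta>})"
        unfolding cl_neg_def down_def up_def by blast
      then show ?thesis
        using * a that Y by (metis in_mono)
    qed
    then show "a \<in> down (Neg A) R Y"
      using a by (auto simp: down_def cl_neg_def)
  qed
  have rows: "down (Neg A) R Y \<subseteq> down (Neg A) R (cl_pos B Y)" if Y: "Y \<subseteq> Pos B" for Y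
  proof
    fix a assume a: "a \<in> down (Neg A) R Y"
    then have "Y \<subseteq> up (Pos B) R {a}"
      using Y by (auto simp: down_def up_def)
    then have "cl_pos B Y \<subseteq> cl_pos B (up (Pos B) R {a})"
      unfolding cl_pos_def down_def up_def by blast
    also have "\<dots> = up (Pos B) R {a}"
      using * a by (auto simp: down_def)
    finally show "a \<in> down (Neg A) R (cl_pos B Y)"
      using a by (auto simp: down_def up_def)
  qed
  have ext: "X \<subseteq> cl_neg A X" if "X \<subseteq> Neg A" for X
    using that by (auto simp: cl_neg_def down_def up_def)
  have "down (Neg A) R (cl_pos B Y) \<subseteq> down (Neg A) R Y" if "Y \<subseteq> Pos B" for Y
    using that by (auto simp: cl_pos_def down_def up_def)
  moreover have "down (Neg A) R Y \<subseteq> Neg A" for Y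
    by (auto simp: down_def)
  ultimately show "compatible A B R"
    unfolding compatible_def using * cols rows ext by (metis subset_antisym)
qed

text \<open>Composition is defined through the columns of \<open>S\<close>. Since the polar maps of \<open>B\<close> are antitone and the
  columns of \<open>S\<close> and the rows of \<open>R\<close> are closed, it can equally be read through the rows of \<open>R\<close>.\<close>

lemma mem_pol_comp_iff:
  assumes R: "compatible A B R" and S: "compatible B C S"
  shows "(a, \<gamma>) \<in> pol_comp A B C R S \<longleftrightarrow> a \<in> Neg A \<and>
    \<gamma> \<in> up (Pos C) S (down (Neg B) (Inc B) (up (Pos B) R {a}))"
proof (cases "a \<in> Neg A \<and> \<gamma> \<in> Pos C")
  case True
  let ?r = "up (Pos B) R {a}" and ?s = "down (Neg B) S {\<gamma>}"
  have r: "cl_pos B ?r = ?r" and s: "cl_neg B ?s = ?s"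
    using R S True by (auto simp: compatible_iff)
  have "(a, \<gamma>) \<in> pol_comp A B C R S \<longleftrightarrow> up (Pos B) (Inc B) ?s \<subseteq> ?r"
    using True unfolding pol_comp_def down_def up_def by auto
  also have "\<dots> \<longleftrightarrow> down (Neg B) (Inc B) ?r \<subseteq> ?s"
  proof
    assume "up (Pos B) (Inc B) ?s \<subseteq> ?r"
    then have "down (Neg B) (Inc B) ?r \<subseteq> cl_neg B ?s"
      unfolding cl_neg_def by (auto simp: down_def[of "Neg B" "Inc B"])
    then show "down (Neg B) (Inc B) ?r \<subseteq> ?s" using s by simp
  next
    assume "down (Neg B) (Inc B) ?r \<subseteq> ?s"
    then have "up (Pos B) (Inc B) ?s \<subseteq> cl_pos B ?r"
      unfolding cl_pos_def by (auto simp: up_def[of "Pos B" "Inc B"])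
    then show "up (Pos B) (Inc B) ?s \<subseteq> ?r" using r by simp
  qed
  also have "\<dots> \<longleftrightarrow> \<gamma> \<in> up (Pos C) S (down (Neg B) (Inc B) ?r)"
    using True by (auto simp: down_def[of "Neg B" S] up_def[of "Pos C" S] down_def[of "Neg B" "Inc B"])
  finally show ?thesis using True by simp
next
  case False
  then show ?thesis by (auto simp: pol_comp_def down_def up_def)
qed

text \<open>Both sides say that the row of \<open>R\<close> at \<open>x\<close> contains the closure of \<open>{p}\<close>, and that row is closed.\<close>

lemma pol_comp_shared_column:
  assumes R: "compatible X L R" and p: "p \<in> Pos L" and \<beta>: "\<beta> \<in> Pos B"
    and col: "down (Neg L) S {\<beta>} = down (Neg L) (Inc L) {p}"
  shows "(x, \<beta>) \<in> pol_comp X L B R S \<longleftrightarrow> (x, p) \<in> R"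
proof -
  have "(x, \<beta>) \<in> pol_comp X L B R S \<longleftrightarrow> x \<in> down (Neg X) R (cl_pos L {p})"
    using \<beta> by (simp add: pol_comp_def col cl_pos_def)
  also have "\<dots> \<longleftrightarrow> x \<in> down (Neg X) R {p}"
    using R p by (simp add: compatible_def)
  also have "\<dots> \<longleftrightarrow> (x, p) \<in> R"
    using R by (auto simp: down_def compatible_def)
  finally show ?thesis .
qed

section \<open>Limits\<close>

text \<open>The equation along \<open>f\<close> compares upper bounds of \<open>X\<^sub>j\<close> with the elements that \<open>F f\<close> relates to all
  of \<open>X\<^sub>i\<close>. For stable sets this says that the sup-preserving map induced by \<open>F f\<close> takes \<open>X\<^sub>i\<close> to \<open>X\<^sub>j\<close>. A set \<open>X\<close>
  encodes the family of its sections; families that agree on \<open>Obj J\<close> have equal rows in the limit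
  polarity, so they name the same element of the lattice of stable sets.\<close>

definition coherent :: "('i, 'm) cat \<Rightarrow> ('i \<Rightarrow> ('a, 'b) polarity) \<Rightarrow> ('m \<Rightarrow> ('a \<times> 'b) set)
    \<Rightarrow> ('i \<times> 'a) set \<Rightarrow> bool" where
  "coherent J D F X \<longleftrightarrow>
     (\<forall>j\<in>Obj J. cl_neg (D j) (X `` {j}) = X `` {j}) \<and>
     (\<forall>f\<in>Arr J. up (Pos (D (Cod J f))) (Inc (D (Cod J f))) (X `` {Cod J f})
        = up (Pos (D (Cod J f))) (F f) (X `` {Dom J f}))"

definition lim_proj :: "('i, 'm) cat \<Rightarrow> ('i \<Rightarrow> ('a, 'b) polarity) \<Rightarrow> ('m \<Rightarrow> ('a \<times> 'b) set)
    \<Rightarrow> 'i \<Rightarrow> (('i \<times> 'a) set \<times> 'b) set" where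
  "lim_proj J D F j = {(X, \<beta>). coherent J D F X \<and> \<beta> \<in> up (Pos (D j)) (Inc (D j)) (X `` {j})}"

definition lim_pol :: "('i, 'm) cat \<Rightarrow> ('i \<Rightarrow> ('a, 'b) polarity) \<Rightarrow> ('m \<Rightarrow> ('a \<times> 'b) set)
    \<Rightarrow> (('i \<times> 'a) set, 'i \<times> 'b) polarity" where
  "lim_pol J D F = \<lparr>Neg = Collect (coherent J D F), Pos = (SIGMA j:Obj J. Pos (D j)),
     Inc = {(X, (j, \<beta>)). j \<in> Obj J \<and> (X, \<beta>) \<in> lim_proj J D F j}\<rparr>"

lemma lim_pol_sel [simp]:
  "X \<in> Neg (lim_pol J D F) \<longleftrightarrow> coherent J D F X"
  "(j, \<beta>) \<in> Pos (lim_pol J D F) \<longleftrightarrow> j \<in> Obj J \<and> \<beta> \<in> Pos (D j)"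
  "(X, (j, \<beta>)) \<in> Inc (lim_pol J D F) \<longleftrightarrow> j \<in> Obj J \<and> (X, \<beta>) \<in> lim_proj J D F j"
  by (auto simp: lim_pol_def)

lemma polarity_lim_pol: "polarity (lim_pol J D F)"
  by (auto simp: polarity_def lim_proj_def up_def)

lemma lim_proj_row:
  "coherent J D F X \<Longrightarrow>
    up (Pos (D j)) (lim_proj J D F j) {X} = up (Pos (D j)) (Inc (D j)) (X `` {j})"
  by (auto simp: lim_proj_def up_def)

lemma lim_proj_column:
  "j \<in> Obj J \<Longrightarrow> down (Neg (lim_pol J D F)) (lim_proj J D F j) {\<beta>}
    = down (Neg (lim_pol J D F)) (Inc (lim_pol J D F)) {(j, \<beta>)}"
  by (auto simp: down_def)

lemma compatible_lim_proj:
  assumes j: "j \<in> Obj J"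
  shows "compatible (lim_pol J D F) (D j) (lim_proj J D F j)"
  unfolding compatible_iff
proof (intro conjI ballI)
  let ?L = "lim_pol J D F"
  show "lim_proj J D F j \<subseteq> Neg ?L \<times> Pos (D j)"
    by (auto simp: lim_proj_def up_def)
  show "cl_neg ?L (down (Neg ?L) (lim_proj J D F j) {\<beta>}) = down (Neg ?L) (lim_proj J D F j) {\<beta>}"
    if "\<beta> \<in> Pos (D j)" for \<beta>
    using that j by (simp add: lim_proj_column cl_neg_down)
  show "cl_pos (D j) (up (Pos (D j)) (lim_proj J D F j) {X}) = up (Pos (D j)) (lim_proj J D F j) {X}"
    if "X \<in> Neg ?L" for X
  proof -
    have "X `` {j} = cl_neg (D j) (X `` {j})"
      using that j by (simp add: coherent_def)
    then have "X `` {j} \<subseteq> Neg (D j)"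
      by (auto simp: cl_neg_def down_def)
    then show ?thesis
      using that by (simp add: lim_proj_row cl_pos_up)
  qed
qed

lemma pol_cone_lim:
  assumes ends: "\<And>f. f \<in> Arr J \<Longrightarrow> Dom J f \<in> Obj J \<and> Cod J f \<in> Obj J"
    and F: "\<And>f. f \<in> Arr J \<Longrightarrow> compatible (D (Dom J f)) (D (Cod J f)) (F f)"
  shows "pol_cone J D F (lim_pol J D F) (lim_proj J D F)"
  unfolding pol_cone_def
proof (intro conjI ballI polarity_lim_pol)
  let ?L = "lim_pol J D F"
  show "compatible ?L (D j) (lim_proj J D F j)" if "j \<in> Obj J" for j
    using that by (rule compatible_lim_proj)
  fix f assume f: "f \<in> Arr J"
  let ?i = "Dom J f" and ?j = "Cod J f"
  have i: "?i \<in> Obj J"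
    using ends f by blast
  have "(X, \<gamma>) \<in> pol_comp ?L (D ?i) (D ?j) (lim_proj J D F ?i) (F f) \<longleftrightarrow> (X, \<gamma>) \<in> lim_proj J D F ?j"
    for X \<gamma>
  proof (cases "coherent J D F X")
    case True
    then have "down (Neg (D ?i)) (Inc (D ?i)) (up (Pos (D ?i)) (lim_proj J D F ?i) {X}) = X `` {?i}"
      using i by (simp add: lim_proj_row coherent_def flip: cl_neg_def)
    then have "(X, \<gamma>) \<in> pol_comp ?L (D ?i) (D ?j) (lim_proj J D F ?i) (F f)
        \<longleftrightarrow> \<gamma> \<in> up (Pos (D ?j)) (F f) (X `` {?i})"
      using True by (simp add: mem_pol_comp_iff[OF compatible_lim_proj[OF i, of D F] F[OF f]])
    moreover have "up (Pos (D ?j)) (F f) (X `` {?i}) = up (Pos (D ?j)) (Inc (D ?j)) (X `` {?j})"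
      using True f by (simp add: coherent_def)
    ultimately show ?thesis
      using True by (simp add: lim_proj_def)
  next
    case False
    then show ?thesis
      by (auto simp: pol_comp_def down_def lim_proj_def)
  qed
  then show "pol_comp ?L (D ?i) (D ?j) (lim_proj J D F ?i) (F f) = lim_proj J D F ?j"
    by auto
qed

definition cone_family :: "('i, 'm) cat \<Rightarrow> ('i \<Rightarrow> ('a, 'b) polarity) \<Rightarrow> ('i \<Rightarrow> ('x \<times> 'b) set)
    \<Rightarrow> 'x \<Rightarrow> ('i \<times> 'a) set" where
  "cone_family J D \<sigma> x = (SIGMA j:Obj J. down (Neg (D j)) (Inc (D j)) (up (Pos (D j)) (\<sigma> j) {x}))"

text \<open>The members of this family are the images of the principal stable set of \<open>x\<close> under the
  sup-preserving maps induced by the legs. Coherence along \<open>f\<close> is the cone equation for \<open>f\<close>,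
  with the composite read through the rows of the leg.\<close>

lemma coherent_of_cone:
  assumes ends: "\<And>f. f \<in> Arr J \<Longrightarrow> Dom J f \<in> Obj J \<and> Cod J f \<in> Obj J"
    and F: "\<And>f. f \<in> Arr J \<Longrightarrow> compatible (D (Dom J f)) (D (Cod J f)) (F f)"
    and \<sigma>: "pol_cone J D F X \<sigma>" and x: "x \<in> Neg X"
  shows "coherent J D F (cone_family J D \<sigma> x)"
    and "j \<in> Obj J \<Longrightarrow> up (Pos (D j)) (Inc (D j)) (cone_family J D \<sigma> x `` {j}) = up (Pos (D j)) (\<sigma> j) {x}"
proof -
  let ?T = "cone_family J D \<sigma> x"
  have T: "?T `` {j} = down (Neg (D j)) (Inc (D j)) (up (Pos (D j)) (\<sigma> j) {x})" if "j \<in> Obj J" for j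
    using that by (auto simp: cone_family_def)
  have leg: "compatible X (D j) (\<sigma> j)" if "j \<in> Obj J" for j
    using \<sigma> that by (simp add: pol_cone_def)
  show row: "up (Pos (D j)) (Inc (D j)) (?T `` {j}) = up (Pos (D j)) (\<sigma> j) {x}" if "j \<in> Obj J" for j
    using leg[OF that] x by (simp add: T[OF that] compatible_iff flip: cl_pos_def)
  show "coherent J D F ?T"
    unfolding coherent_def
  proof (intro conjI ballI)
    show "cl_neg (D j) (?T `` {j}) = ?T `` {j}" if "j \<in> Obj J" for j
      by (simp add: T[OF that] cl_neg_down up_def)
    fix f assume f: "f \<in> Arr J"
    let ?i = "Dom J f" and ?j = "Cod J f"
    have i: "?i \<in> Obj J" and j: "?j \<in> Obj J"
      using ends f by auto
    have comp: "pol_comp X (D ?i) (D ?j) (\<sigma> ?i) (F f) = \<sigma> ?j"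
      using \<sigma> f by (simp add: pol_cone_def)
    have "(x, \<gamma>) \<in> \<sigma> ?j \<longleftrightarrow> \<gamma> \<in> up (Pos (D ?j)) (F f) (?T `` {?i})" for \<gamma>
      using mem_pol_comp_iff[OF leg[OF i] F[OF f], of x \<gamma>] x by (simp add: comp T[OF i])
    then have "up (Pos (D ?j)) (\<sigma> ?j) {x} = up (Pos (D ?j)) (F f) (?T `` {?i})"
      by (auto simp: up_def)
    then show "up (Pos (D ?j)) (Inc (D ?j)) (?T `` {?j}) = up (Pos (D ?j)) (F f) (?T `` {?i})"
      by (simp add: row[OF j])
  qed
qed

theorem pol_limit_lim_pol:
  assumes ends: "\<And>f. f \<in> Arr J \<Longrightarrow> Dom J f \<in> Obj J \<and> Cod J f \<in> Obj J"
    and F: "\<And>f. f \<in> Arr J \<Longrightarrow> compatible (D (Dom J f)) (D (Cod J f)) (F f)"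
  shows "pol_limit TYPE('x) TYPE('y) J D F (lim_pol J D F) (lim_proj J D F)"
  unfolding pol_limit_def
proof (intro conjI allI impI)
  let ?L = "lim_pol J D F"
  show "pol_cone J D F ?L (lim_proj J D F)"
    using assms by (rule pol_cone_lim)
  fix X :: "('x, 'y) polarity" and \<sigma>
  assume \<sigma>: "pol_cone J D F X \<sigma>"
  have leg: "compatible X (D j) (\<sigma> j)" if "j \<in> Obj J" for j
    using \<sigma> that by (simp add: pol_cone_def)
  then have leg_sub: "\<sigma> j \<subseteq> Neg X \<times> Pos (D j)" if "j \<in> Obj J" for j
    using that by (simp add: compatible_def)
  have read: "(x, \<beta>) \<in> pol_comp X ?L (D j) R (lim_proj J D F j) \<longleftrightarrow> (x, (j, \<beta>)) \<in> R"
    if "compatible X ?L R" "j \<in> Obj J" "\<beta> \<in> Pos (D j)" for R x j \<beta>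
    using that by (intro pol_comp_shared_column lim_proj_column) auto
  \<comment> \<open>By \<open>read\<close>, the columns of a mediating relation must be the columns of the legs.\<close>
  define M where "M = {(x, (j, \<beta>)). j \<in> Obj J \<and> (x, \<beta>) \<in> \<sigma> j}"
  have M: "compatible X ?L M"
    unfolding compatible_iff
  proof (intro conjI ballI)
    show "M \<subseteq> Neg X \<times> Pos ?L"
      using leg_sub by (fastforce simp: M_def)
    show "cl_neg X (down (Neg X) M {p}) = down (Neg X) M {p}" if p: "p \<in> Pos ?L" for p
    proof -
      obtain j \<beta> where [simp]: "p = (j, \<beta>)" by fastforce
      have "down (Neg X) M {p} = down (Neg X) (\<sigma> j) {\<beta>}"
        using p by (auto simp: M_def down_def)
      then show ?thesis
        using leg p by (simp add: compatible_iff)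
    qed
    show "cl_pos ?L (up (Pos ?L) M {x}) = up (Pos ?L) M {x}" if x: "x \<in> Neg X" for x
    proof -
      let ?T = "cone_family J D \<sigma> x"
      have T: "coherent J D F ?T"
        using ends F \<sigma> x by (rule coherent_of_cone)
      have "(x, \<beta>) \<in> \<sigma> j \<longleftrightarrow> (?T, \<beta>) \<in> lim_proj J D F j" if "j \<in> Obj J" "\<beta> \<in> Pos (D j)" for j \<beta>
      proof -
        have "up (Pos (D j)) (Inc (D j)) (?T `` {j}) = up (Pos (D j)) (\<sigma> j) {x}"
          using ends F \<sigma> x that(1) by (rule coherent_of_cone)
        then have "(?T, \<beta>) \<in> lim_proj J D F j \<longleftrightarrow> \<beta> \<in> up (Pos (D j)) (\<sigma> j) {x}"
          using T by (simp add: lim_proj_def)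
        then show ?thesis
          using that by (simp add: up_def)
      qed
      then have "up (Pos ?L) M {x} = up (Pos ?L) (Inc ?L) {?T}"
        by (auto simp: M_def up_def)
      then show ?thesis
        using T by (simp add: cl_pos_up)
    qed
  qed
  show "\<exists>!R. compatible X ?L R \<and> (\<forall>j\<in>Obj J. pol_comp X ?L (D j) R (lim_proj J D F j) = \<sigma> j)"
  proof (rule ex1I[of _ M], intro conjI ballI M)
    show "pol_comp X ?L (D j) M (lim_proj J D F j) = \<sigma> j" if j: "j \<in> Obj J" for j
    proof -
      have "pol_comp X ?L (D j) M (lim_proj J D F j) \<subseteq> Neg X \<times> Pos (D j)"
        by (rule pol_comp_subset)
      moreover have "(x, \<beta>) \<in> pol_comp X ?L (D j) M (lim_proj J D F j) \<longleftrightarrow> (x, \<beta>) \<in> \<sigma> j"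
        if "\<beta> \<in> Pos (D j)" for x \<beta>
        using read[OF M j that] j by (simp add: M_def)
      ultimately show ?thesis
        using leg_sub[OF j] by auto
    qed
  next
    fix R
    assume R: "compatible X ?L R \<and> (\<forall>j\<in>Obj J. pol_comp X ?L (D j) R (lim_proj J D F j) = \<sigma> j)"
    then have "R \<subseteq> Neg X \<times> Pos ?L"
      by (simp add: compatible_def)
    moreover have "(x, (j, \<beta>)) \<in> R \<longleftrightarrow> (x, (j, \<beta>)) \<in> M" if "(j, \<beta>) \<in> Pos ?L" for x j \<beta>
      using that R read[of R j \<beta> x] by (simp add: M_def)
    moreover have "M \<subseteq> Neg X \<times> Pos ?L"
      using M by (simp add: compatible_def)
    ultimately show "R = M"
      by (auto 4 3)
  qed
qed

section \<open>Duality and colimits\<close>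

definition dual_pol :: "('a, 'b) polarity \<Rightarrow> ('b, 'a) polarity" where
  "dual_pol A = \<lparr>Neg = Pos A, Pos = Neg A, Inc = (Inc A)\<inverse>\<rparr>"

definition dual_cat :: "('i, 'm) cat \<Rightarrow> ('i, 'm) cat" where
  "dual_cat J = \<lparr>Obj = Obj J, Arr = Arr J, Dom = Cod J, Cod = Dom J, Id = Id J,
     Comp = (\<lambda>f g. Comp J g f)\<rparr>"

lemma dual_pol_sel [simp]:
  "Neg (dual_pol A) = Pos A" "Pos (dual_pol A) = Neg A" "Inc (dual_pol A) = (Inc A)\<inverse>"
  by (simp_all add: dual_pol_def)

lemma dual_cat_sel [simp]:
  "Obj (dual_cat J) = Obj J" "Arr (dual_cat J) = Arr J"
  "Dom (dual_cat J) = Cod J" "Cod (dual_cat J) = Dom J"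
  by (simp_all add: dual_cat_def)

lemma dual_dual_pol [simp]: "dual_pol (dual_pol A) = A"
  by (simp add: dual_pol_def)

lemma polarity_dual [simp]: "polarity (dual_pol A) \<longleftrightarrow> polarity A"
  by (auto simp: polarity_def)

lemma down_converse: "down A (R\<inverse>) Y = up A R Y"
  by (auto simp: down_def up_def)

lemma up_converse: "up B (R\<inverse>) X = down B R X"
  by (auto simp: down_def up_def)

lemma compatible_dual:
  "compatible (dual_pol B) (dual_pol A) (R\<inverse>) \<longleftrightarrow> compatible A B R"
  by (auto simp: compatible_iff cl_neg_def cl_pos_def down_converse up_converse)

lemma pol_comp_dual:
  assumes "compatible A B R" "compatible B C S"
  shows "pol_comp (dual_pol C) (dual_pol B) (dual_pol A) (S\<inverse>) (R\<inverse>) = (pol_comp A B C R S)\<inverse>"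
proof -
  have "(\<gamma>, a) \<in> pol_comp (dual_pol C) (dual_pol B) (dual_pol A) (S\<inverse>) (R\<inverse>)
      \<longleftrightarrow> (a, \<gamma>) \<in> pol_comp A B C R S" for a \<gamma>
    by (simp add: mem_pol_comp_iff[OF assms]) (simp add: pol_comp_def down_converse up_converse)
  then show ?thesis
    by auto
qed

lemma pol_cone_dual:
  assumes ends: "\<And>f. f \<in> Arr J \<Longrightarrow> Dom J f \<in> Obj J \<and> Cod J f \<in> Obj J"
    and F: "\<And>f. f \<in> Arr J \<Longrightarrow> compatible (D (Dom J f)) (D (Cod J f)) (F f)"
  shows "pol_cone (dual_cat J) (\<lambda>j. dual_pol (D j)) (\<lambda>f. (F f)\<inverse>) (dual_pol X) (\<lambda>j. (\<sigma> j)\<inverse>)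
    \<longleftrightarrow> pol_cocone J D F X \<sigma>"
proof -
  have "pol_comp (dual_pol X) (dual_pol (D (Cod J f))) (dual_pol (D (Dom J f))) ((\<sigma> (Cod J f))\<inverse>) ((F f)\<inverse>)
        = (\<sigma> (Dom J f))\<inverse>
      \<longleftrightarrow> pol_comp (D (Dom J f)) (D (Cod J f)) X (F f) (\<sigma> (Cod J f)) = \<sigma> (Dom J f)"
    if "f \<in> Arr J" "\<forall>j\<in>Obj J. compatible (D j) X (\<sigma> j)" for f
    using that ends[of f] by (simp add: pol_comp_dual[OF F])
  then show ?thesis
    unfolding pol_cone_def pol_cocone_def by (auto simp: compatible_dual)
qed

text \<open>The test apexes exchange their two types, since a cocone with apex \<open>X\<close> is a cone with apex the dual
  of \<open>X\<close>.\<close>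

lemma pol_colimit_of_dual_limit:
  assumes ends: "\<And>f. f \<in> Arr J \<Longrightarrow> Dom J f \<in> Obj J \<and> Cod J f \<in> Obj J"
    and F: "\<And>f. f \<in> Arr J \<Longrightarrow> compatible (D (Dom J f)) (D (Cod J f)) (F f)"
    and L: "pol_limit TYPE('y) TYPE('x) (dual_cat J) (\<lambda>j. dual_pol (D j)) (\<lambda>f. (F f)\<inverse>) L \<pi>"
  shows "pol_colimit TYPE('x) TYPE('y) J D F (dual_pol L) (\<lambda>j. (\<pi> j)\<inverse>)"
  unfolding pol_colimit_def
proof (intro conjI allI impI)
  have "pol_cone (dual_cat J) (\<lambda>j. dual_pol (D j)) (\<lambda>f. (F f)\<inverse>) L \<pi>"
    using L by (simp add: pol_limit_def)
  then show C: "pol_cocone J D F (dual_pol L) (\<lambda>j. (\<pi> j)\<inverse>)"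
    using pol_cone_dual[OF ends F, where X = "dual_pol L" and \<sigma> = "\<lambda>j. (\<pi> j)\<inverse>"] by simp
  fix X :: "('x, 'y) polarity" and \<sigma>
  assume "pol_cocone J D F X \<sigma>"
  then have "pol_cone (dual_cat J) (\<lambda>j. dual_pol (D j)) (\<lambda>f. (F f)\<inverse>) (dual_pol X) (\<lambda>j. (\<sigma> j)\<inverse>)"
    using pol_cone_dual[OF ends F] by blast
  then have "\<exists>!R. compatible (dual_pol X) L R \<and>
      (\<forall>j\<in>Obj J. pol_comp (dual_pol X) L (dual_pol (D j)) R (\<pi> j) = (\<sigma> j)\<inverse>)" (is "\<exists>!R. ?med R")
    using L by (simp add: pol_limit_def)
  moreover have "?med (R\<inverse>) \<longleftrightarrow> compatible (dual_pol L) X R \<and>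
      (\<forall>j\<in>Obj J. pol_comp (D j) (dual_pol L) X ((\<pi> j)\<inverse>) R = \<sigma> j)" (is "_ \<longleftrightarrow> ?comed R") for R
  proof -
    have "pol_comp (dual_pol X) L (dual_pol (D j)) (R\<inverse>) (\<pi> j)
        = (pol_comp (D j) (dual_pol L) X ((\<pi> j)\<inverse>) R)\<inverse>"
      if "compatible (dual_pol L) X R" "j \<in> Obj J" for j
      using pol_comp_dual[of "D j" "dual_pol L" "(\<pi> j)\<inverse>" X R] C that by (simp add: pol_cocone_def)
    then show ?thesis
      using compatible_dual[of X "dual_pol L" R] by auto
  qed
  ultimately show "\<exists>!R. ?comed R"
    by (metis converse_converse)
qed

definition colim_pol :: "('i, 'm) cat \<Rightarrow> ('i \<Rightarrow> ('a, 'b) polarity) \<Rightarrow> ('m \<Rightarrow> ('a \<times> 'b) set)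
    \<Rightarrow> ('i \<times> 'a, ('i \<times> 'b) set) polarity" where
  "colim_pol J D F = dual_pol (lim_pol (dual_cat J) (\<lambda>j. dual_pol (D j)) (\<lambda>f. (F f)\<inverse>))"

definition colim_inj :: "('i, 'm) cat \<Rightarrow> ('i \<Rightarrow> ('a, 'b) polarity) \<Rightarrow> ('m \<Rightarrow> ('a \<times> 'b) set)
    \<Rightarrow> 'i \<Rightarrow> ('a \<times> ('i \<times> 'b) set) set" where
  "colim_inj J D F j = (lim_proj (dual_cat J) (\<lambda>j. dual_pol (D j)) (\<lambda>f. (F f)\<inverse>) j)\<inverse>"

theorem pol_colimit_colim_pol:
  assumes ends: "\<And>f. f \<in> Arr J \<Longrightarrow> Dom J f \<in> Obj J \<and> Cod J f \<in> Obj J"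
    and F: "\<And>f. f \<in> Arr J \<Longrightarrow> compatible (D (Dom J f)) (D (Cod J f)) (F f)"
  shows "pol_colimit TYPE('x) TYPE('y) J D F (colim_pol J D F) (colim_inj J D F)"
  unfolding colim_pol_def colim_inj_def
proof (rule pol_colimit_of_dual_limit)
  show "pol_limit TYPE('y) TYPE('x) (dual_cat J) (\<lambda>j. dual_pol (D j)) (\<lambda>f. (F f)\<inverse>)
      (lim_pol (dual_cat J) (\<lambda>j. dual_pol (D j)) (\<lambda>f. (F f)\<inverse>))
      (lim_proj (dual_cat J) (\<lambda>j. dual_pol (D j)) (\<lambda>f. (F f)\<inverse>))"
    by (rule pol_limit_lim_pol) (simp_all add: ends F compatible_dual)
qed (use ends F in auto)

section \<open>Completeness and cocompleteness\<close>

theorem theorem6p3: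
  fixes J :: "('i, 'm) cat"
    and D :: "'i \<Rightarrow> ('a, 'b) polarity"
    and F :: "'m \<Rightarrow> ('a \<times> 'b) set"
  assumes "category J" and "pol_diagram J D F"
  shows
    "(\<exists>(L :: (('i \<times> 'a) set, 'i \<times> 'b) polarity) \<pi>.
        pol_limit TYPE(('i \<times> 'a) set) TYPE('i \<times> 'b) J D F L \<pi> \<and>
        pol_limit TYPE('x) TYPE('y) J D F L \<pi>) \<and>
     (\<exists>(C :: ('i \<times> 'a, ('i \<times> 'b) set) polarity) \<iota>.
        pol_colimit TYPE('i \<times> 'a) TYPE(('i \<times> 'b) set) J D F C \<iota> \<and>
        pol_colimit TYPE('x) TYPE('y) J D F C \<iota>)"
proof -
  have ends: "Dom J f \<in> Obj J \<and> Cod J f \<in> Obj J" if "f \<in> Arr J" for f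
    using assms(1) that by (simp add: category.Dom_in category.Cod_in)
  have F: "compatible (D (Dom J f)) (D (Cod J f)) (F f)" if "f \<in> Arr J" for f
    using assms(2) that by (simp add: pol_diagram_def)
  show ?thesis
  proof (intro conjI exI)
    let ?L = "lim_pol J D F" and ?\<pi> = "lim_proj J D F"
    show "pol_limit TYPE(('i \<times> 'a) set) TYPE('i \<times> 'b) J D F ?L ?\<pi>"
      and "pol_limit TYPE('x) TYPE('y) J D F ?L ?\<pi>"
      by (simp_all add: pol_limit_lim_pol ends F)
    let ?C = "colim_pol J D F" and ?\<iota> = "colim_inj J D F"
    show "pol_colimit TYPE('i \<times> 'a) TYPE(('i \<times> 'b) set) J D F ?C ?\<iota>"
      and "pol_colimit TYPE('x) TYPE('y) J D F ?C ?\<iota>"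
      by (simp_all add: pol_colimit_colim_pol ends F)
  qed
qed

end
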